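(* Let $Y$ be a simplicial set and let $(s,t) : R \to Y\times Y$ be a pseudo-equivalence relation on $Y$ in the category of simplicial sets such that $(s,t) : R\to Y\times Y$ is a Kan fibration. If $Y$ is a Kan complex, then the quotient $Y/R$ is a Kan complex and the quotient map $Y\to Y/R$ is a Kan fibration.
   Context: A map $(s,t) : R\to Y\times Y$ is a pseudo-equivalence relation on $Y$ if: (i) there is a map $\rho : Y\to R$ such that $(s,t)\rho$ is the diagonal $Y\to Y\times Y$; (ii) there is a map $\sigma : R\to R$ with $s\sigma = t$ and $t\sigma = s$; (iii) if $P$ is the pullback of $t : R\to Y$ and $s : R\to Y$, with projections $p_{12}, p_{23} : P\to R$ satisfying $t p_{12} = s p_{23}$, then there is a map $\tau : P\to R$ with $s\tau = s p_{12}$ and $t\tau = t p_{23}$. The map $(s,t)$ is not required to be monic. The quotient $Y/R$ is the coequalizer of $s,t : R\rightrightarrows Y$. *)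

theory Defs
  imports Main "HOL-Library.FuncSet"
begin

section \<open>Simplicial sets\<close>

text \<open>
  The simplex category has the ordinals \<open>[n] = {..n}\<close> as objects. Morphisms are
  extensional functions, so that equality in HOL is equality of monotone maps.
\<close>

definition delta_hom :: "nat \<Rightarrow> nat \<Rightarrow> (nat \<Rightarrow> nat) set" where
  "delta_hom m n = {f \<in> {..m} \<rightarrow>\<^sub>E {..n}. mono_on {..m} f}"

definition delta_id :: "nat \<Rightarrow> nat \<Rightarrow> nat" where
  "delta_id n = restrict id {..n}"

definition delta_comp :: "nat \<Rightarrow> (nat \<Rightarrow> nat) \<Rightarrow> (nat \<Rightarrow> nat) \<Rightarrow> nat \<Rightarrow> nat" where
  "delta_comp m g f = compose {..m} g f"

text \<open>
  For \<open>f \<in> delta_hom m n\<close>, \<open>act X m n f\<close> is the contravariant action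
  \<open>X\<^sub>n \<Rightarrow> X\<^sub>m\<close>. Its values on other arguments are irrelevant.
\<close>

record 'a sset =
  simplices :: "nat \<Rightarrow> 'a set"
  act :: "nat \<Rightarrow> nat \<Rightarrow> (nat \<Rightarrow> nat) \<Rightarrow> 'a \<Rightarrow> 'a"

definition simplicial_set :: "'a sset \<Rightarrow> bool" where
  "simplicial_set X \<longleftrightarrow>
    (\<forall>m n. \<forall>f \<in> delta_hom m n. act X m n f \<in> simplices X n \<rightarrow> simplices X m) \<and>
    (\<forall>n. \<forall>x \<in> simplices X n. act X n n (delta_id n) x = x) \<and>
    (\<forall>l m n. \<forall>f \<in> delta_hom l m. \<forall>g \<in> delta_hom m n. \<forall>x \<in> simplices X n.
      act X l n (delta_comp l g f) x = act X l m f (act X m n g x))"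

type_synonym ('a, 'b) smap = "nat \<Rightarrow> 'a \<Rightarrow> 'b"

definition simplicial_map :: "'a sset \<Rightarrow> 'b sset \<Rightarrow> ('a, 'b) smap \<Rightarrow> bool" where
  "simplicial_map X Y p \<longleftrightarrow>
    (\<forall>n. p n \<in> simplices X n \<rightarrow> simplices Y n) \<and>
    (\<forall>m n. \<forall>f \<in> delta_hom m n. \<forall>x \<in> simplices X n.
      p m (act X m n f x) = act Y m n f (p n x))"

text \<open>
  The components of a simplicial map are total functions in HOL; \<open>smap_eq X\<close> is
  equality of two simplicial maps with domain \<open>X\<close>.
\<close>

definition smap_eq :: "'a sset \<Rightarrow> ('a, 'b) smap \<Rightarrow> ('a, 'b) smap \<Rightarrow> bool" where
  "smap_eq X p q \<longleftrightarrow> (\<forall>n. \<forall>x \<in> simplices X n. p n x = q n x)"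

definition smap_id :: "('a, 'a) smap" where
  "smap_id = (\<lambda>n x. x)"

definition smap_comp :: "('b, 'c) smap \<Rightarrow> ('a, 'b) smap \<Rightarrow> ('a, 'c) smap"  (infixr "\<odot>" 65)
  where "q \<odot> p = (\<lambda>n. q n \<circ> p n)"

section \<open>Finite limits\<close>

definition sset_point :: "unit sset" where
  "sset_point = \<lparr>simplices = (\<lambda>n. {()}), act = (\<lambda>m n f x. x)\<rparr>"

definition smap_to_point :: "('a, unit) smap" where
  "smap_to_point = (\<lambda>n x. ())"

definition sset_prod :: "'a sset \<Rightarrow> 'b sset \<Rightarrow> ('a \<times> 'b) sset" where
  "sset_prod X Y =
    \<lparr>simplices = (\<lambda>n. simplices X n \<times> simplices Y n),
     act = (\<lambda>m n f. map_prod (act X m n f) (act Y m n f))\<rparr>"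

definition smap_pair :: "('c, 'a) smap \<Rightarrow> ('c, 'b) smap \<Rightarrow> ('c, 'a \<times> 'b) smap" where
  "smap_pair p q = (\<lambda>n x. (p n x, q n x))"

definition sset_pullback ::
  "'a sset \<Rightarrow> 'b sset \<Rightarrow> ('a, 'c) smap \<Rightarrow> ('b, 'c) smap \<Rightarrow> ('a \<times> 'b) sset" where
  "sset_pullback X Y p q =
    \<lparr>simplices = (\<lambda>n. {(x, y) \<in> simplices X n \<times> simplices Y n. p n x = q n y}),
     act = act (sset_prod X Y)\<rparr>"

definition smap_fst :: "('a \<times> 'b, 'a) smap" where
  "smap_fst = (\<lambda>n. fst)"

definition smap_snd :: "('a \<times> 'b, 'b) smap" where
  "smap_snd = (\<lambda>n. snd)"

section \<open>Kan fibrations and Kan complexes\<close>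

definition std_simplex :: "nat \<Rightarrow> (nat \<Rightarrow> nat) sset" where
  "std_simplex n =
    \<lparr>simplices = (\<lambda>m. delta_hom m n), act = (\<lambda>l m f x. delta_comp l x f)\<rparr>"

text \<open>
  The horn is the union of the faces of the standard simplex opposite to the vertices
  \<open>j \<noteq> k\<close>; a simplex lies in the face opposite to \<open>j\<close> iff it omits the vertex \<open>j\<close>.
\<close>

definition horn :: "nat \<Rightarrow> nat \<Rightarrow> (nat \<Rightarrow> nat) sset" where
  "horn n k =
    \<lparr>simplices = (\<lambda>m. {x \<in> delta_hom m n. \<exists>j \<le> n. j \<noteq> k \<and> j \<notin> x ` {..m}}),
     act = act (std_simplex n)\<rparr>"

text \<open>
  Since the horn is a simplicial subset of the standard simplex, restricting a map along
  the inclusion is comparing it on \<open>horn n k\<close> only.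
\<close>

definition kan_fibration :: "'a sset \<Rightarrow> 'b sset \<Rightarrow> ('a, 'b) smap \<Rightarrow> bool" where
  "kan_fibration X Y p \<longleftrightarrow>
    simplicial_map X Y p \<and>
    (\<forall>n k u v. 1 \<le> n \<and> k \<le> n \<and>
      simplicial_map (horn n k) X u \<and> simplicial_map (std_simplex n) Y v \<and>
      smap_eq (horn n k) (p \<odot> u) v \<longrightarrow>
      (\<exists>w. simplicial_map (std_simplex n) X w \<and>
        smap_eq (horn n k) w u \<and> smap_eq (std_simplex n) (p \<odot> w) v))"

definition kan_complex :: "'a sset \<Rightarrow> bool" where
  "kan_complex X \<longleftrightarrow> simplicial_set X \<and> kan_fibration X sset_point smap_to_point"

section \<open>Pseudo-equivalence relations\<close>

definition pseudo_equivalence_relation ::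
  "'a sset \<Rightarrow> 'b sset \<Rightarrow> ('b, 'a) smap \<Rightarrow> ('b, 'a) smap \<Rightarrow> bool" where
  "pseudo_equivalence_relation Y R s t \<longleftrightarrow>
    simplicial_map R (sset_prod Y Y) (smap_pair s t) \<and>
    (\<exists>\<rho>. simplicial_map Y R \<rho> \<and>
      smap_eq Y (smap_pair s t \<odot> \<rho>) (smap_pair smap_id smap_id)) \<and>
    (\<exists>\<sigma>. simplicial_map R R \<sigma> \<and> smap_eq R (s \<odot> \<sigma>) t \<and> smap_eq R (t \<odot> \<sigma>) s) \<and>
    (let P = sset_pullback R R t s; p12 = smap_fst; p23 = smap_snd in
      \<exists>\<tau>. simplicial_map P R \<tau> \<and>
        smap_eq P (s \<odot> \<tau>) (s \<odot> p12) \<and> smap_eq P (t \<odot> \<tau>) (t \<odot> p23))"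

section \<open>Coequalizers\<close>

text \<open>
  The universal property of a coequalizer \<open>q : Y \<rightarrow> Q\<close> of \<open>s, t : R \<rightrightarrows> Y\<close>, with the
  test objects ranging over the simplicial sets whose simplices are of type \<open>'d\<close>.
\<close>

definition coequalizer_wrt ::
  "'d itself \<Rightarrow> 'b sset \<Rightarrow> 'a sset \<Rightarrow> ('b, 'a) smap \<Rightarrow> ('b, 'a) smap \<Rightarrow>
    'c sset \<Rightarrow> ('a, 'c) smap \<Rightarrow> bool" where
  "coequalizer_wrt (_ :: 'd itself) R Y s t Q q \<longleftrightarrow>
    simplicial_set Q \<and> simplicial_map Y Q q \<and> smap_eq R (q \<odot> s) (q \<odot> t) \<and>
    (\<forall>(Z :: 'd sset) g.
      simplicial_set Z \<and> simplicial_map Y Z g \<and> smap_eq R (g \<odot> s) (g \<odot> t) \<longrightarrow>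
      (\<exists>h. simplicial_map Q Z h \<and> smap_eq Y (h \<odot> q) g \<and>
        (\<forall>h'. simplicial_map Q Z h' \<and> smap_eq Y (h' \<odot> q) g \<longrightarrow> smap_eq Q h' h)))"

text \<open>
  HOL cannot quantify over the type of the test objects. The type \<open>'a + 'c\<close> has room for
  \<open>Q\<close> and for every quotient of \<open>Y\<close>, and this is enough: \<open>is_coequalizer_any\<close> below gives
  the universal property with respect to test objects of an arbitrary type.
\<close>

definition is_coequalizer ::
  "'b sset \<Rightarrow> 'a sset \<Rightarrow> ('b, 'a) smap \<Rightarrow> ('b, 'a) smap \<Rightarrow>
    'c sset \<Rightarrow> ('a, 'c) smap \<Rightarrow> bool" where
  "is_coequalizer R Y s t (Q :: 'c sset) q \<longleftrightarrow>
    coequalizer_wrt TYPE('a + 'c) R (Y :: 'a sset) s t Q q"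

definition coeq_rel ::
  "'b sset \<Rightarrow> ('b, 'a) smap \<Rightarrow> ('b, 'a) smap \<Rightarrow> nat \<Rightarrow> ('a \<times> 'a) set" where
  "coeq_rel R s t n = (let G = (\<lambda>r. (s n r, t n r)) ` simplices R n in (G \<union> G\<inverse>)\<^sup>*)"

lemma coeq_rel_refl [simp]: "(x, x) \<in> coeq_rel R s t n"
  by (simp add: coeq_rel_def Let_def)

lemma coeq_rel_sym: "(x, y) \<in> coeq_rel R s t n \<Longrightarrow> (y, x) \<in> coeq_rel R s t n"
proof -
  have "sym (coeq_rel R s t n)"
    unfolding coeq_rel_def Let_def by (intro sym_rtrancl sym_Un_converse)
  then show "(x, y) \<in> coeq_rel R s t n \<Longrightarrow> (y, x) \<in> coeq_rel R s t n"
    by (rule symD)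
qed

lemma coeq_rel_trans:
  "(x, y) \<in> coeq_rel R s t n \<Longrightarrow> (y, z) \<in> coeq_rel R s t n \<Longrightarrow> (x, z) \<in> coeq_rel R s t n"
  unfolding coeq_rel_def Let_def by (rule rtrancl_trans)

lemma coeq_rel_gen: "r \<in> simplices R n \<Longrightarrow> (s n r, t n r) \<in> coeq_rel R s t n"
  unfolding coeq_rel_def Let_def by (intro r_into_rtrancl) blast

lemma coeq_rel_induct [consumes 1, case_names refl trans sym gen]:
  assumes "(x, y) \<in> coeq_rel R s t n"
    and "\<And>x. P x x"
    and "\<And>x y z. P x y \<Longrightarrow> P y z \<Longrightarrow> P x z"
    and "\<And>x y. P x y \<Longrightarrow> P y x"
    and "\<And>r. r \<in> simplices R n \<Longrightarrow> P (s n r) (t n r)"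
  shows "P x y"
  using assms(1) unfolding coeq_rel_def Let_def
proof (induction rule: rtrancl_induct)
  case base
  show ?case by (rule assms(2))
next
  case (step y z)
  have "P y z" using step(2) assms(4,5) by auto
  with step(3) show ?case by (rule assms(3))
qed

text \<open>
  The levelwise quotient, with its classes replaced by chosen representatives so that it
  lives on the same type as \<open>Y\<close>. It shows that coequalizers exist.
\<close>

definition coeq_rep :: "'b sset \<Rightarrow> ('b, 'a) smap \<Rightarrow> ('b, 'a) smap \<Rightarrow> 'a sset \<Rightarrow> ('a, 'a) smap"
  where "coeq_rep R s t Y n x = (SOME y. y \<in> simplices Y n \<and> (x, y) \<in> coeq_rel R s t n)"

definition coeq_sset :: "'b sset \<Rightarrow> ('b, 'a) smap \<Rightarrow> ('b, 'a) smap \<Rightarrow> 'a sset \<Rightarrow> 'a sset" where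
  "coeq_sset R s t Y =
    \<lparr>simplices = (\<lambda>n. coeq_rep R s t Y n ` simplices Y n),
     act = (\<lambda>m n f x. coeq_rep R s t Y m (act Y m n f x))\<rparr>"

lemma coeq_rep:
  assumes "x \<in> simplices Y n"
  shows "coeq_rep R s t Y n x \<in> simplices Y n" "(x, coeq_rep R s t Y n x) \<in> coeq_rel R s t n"
proof -
  have "\<exists>y. y \<in> simplices Y n \<and> (x, y) \<in> coeq_rel R s t n"
    using assms by (intro exI[of _ x]) simp
  from someI_ex[OF this]
  show "coeq_rep R s t Y n x \<in> simplices Y n" "(x, coeq_rep R s t Y n x) \<in> coeq_rel R s t n"
    by (auto simp: coeq_rep_def)
qed

lemma coeq_rep_eq: "(x, y) \<in> coeq_rel R s t n \<Longrightarrow> coeq_rep R s t Y n x = coeq_rep R s t Y n y"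
proof -
  assume "(x, y) \<in> coeq_rel R s t n"
  then have "(x, z) \<in> coeq_rel R s t n \<longleftrightarrow> (y, z) \<in> coeq_rel R s t n" for z
    using coeq_rel_sym coeq_rel_trans by metis
  then show ?thesis by (simp add: coeq_rep_def)
qed

lemma coeq_rep_eq_iff:
  assumes "x \<in> simplices Y n" "y \<in> simplices Y n"
  shows "coeq_rep R s t Y n x = coeq_rep R s t Y n y \<longleftrightarrow> (x, y) \<in> coeq_rel R s t n"
  using coeq_rep(2)[OF assms(1)] coeq_rep(2)[OF assms(2)] coeq_rep_eq coeq_rel_sym coeq_rel_trans
  by metis

lemma coeq_rel_act:
  assumes Y: "simplicial_set Y" and R: "simplicial_set R"
    and s: "simplicial_map R Y s" and t: "simplicial_map R Y t"
    and f: "f \<in> delta_hom m n" and xy: "(x, y) \<in> coeq_rel R s t n"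
  shows "(act Y m n f x, act Y m n f y) \<in> coeq_rel R s t m"
  using xy
proof (induction rule: coeq_rel_induct)
  case (gen r)
  have "act R m n f r \<in> simplices R m" using R f gen by (auto simp: simplicial_set_def)
  from coeq_rel_gen[where s = s and t = t, OF this] show ?case using s t f gen
    by (auto simp: simplicial_map_def)
qed (auto intro: coeq_rel_sym coeq_rel_trans)

lemma coeq_sset:
  assumes Y: "simplicial_set Y" and R: "simplicial_set R"
    and s: "simplicial_map R Y s" and t: "simplicial_map R Y t"
  shows "simplicial_set (coeq_sset R s t Y)"
    and "simplicial_map Y (coeq_sset R s t Y) (coeq_rep R s t Y)"
    and "smap_eq R (coeq_rep R s t Y \<odot> s) (coeq_rep R s t Y \<odot> t)"
proof -
  let ?c = "coeq_rep R s t Y"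
  have nat: "?c m (act Y m n f (?c n x)) = ?c m (act Y m n f x)"
    if "f \<in> delta_hom m n" "x \<in> simplices Y n" for m n f x
    using coeq_rel_act[OF assms that(1)] coeq_rep(2)[OF that(2)] coeq_rep_eq by metis
  have idem: "?c n (?c n x) = ?c n x" if "x \<in> simplices Y n" for n x
    using coeq_rep(2)[OF that] coeq_rep_eq by metis
  have cl: "act Y m n f x \<in> simplices Y m" if "f \<in> delta_hom m n" "x \<in> simplices Y n" for m n f x
    using Y that by (auto simp: simplicial_set_def)
  show "simplicial_set (coeq_sset R s t Y)"
    unfolding simplicial_set_def
  proof (intro conjI allI ballI)
    fix m n f assume "f \<in> delta_hom m n"
    then show "act (coeq_sset R s t Y) m n f \<in>
        simplices (coeq_sset R s t Y) n \<rightarrow> simplices (coeq_sset R s t Y) m"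
      using cl coeq_rep(1) by (fastforce simp: coeq_sset_def)
  next
    fix n x assume "x \<in> simplices (coeq_sset R s t Y) n"
    then obtain y where y: "y \<in> simplices Y n" "x = ?c n y" by (auto simp: coeq_sset_def)
    then have "act Y n n (delta_id n) x = x"
      using Y coeq_rep(1)[OF y(1), of R s t] by (simp add: simplicial_set_def)
    then show "act (coeq_sset R s t Y) n n (delta_id n) x = x"
      using y idem by (simp add: coeq_sset_def)
  next
    fix l m n f g x
    assume f: "f \<in> delta_hom l m" and g: "g \<in> delta_hom m n"
      and "x \<in> simplices (coeq_sset R s t Y) n"
    then have x: "x \<in> simplices Y n" using coeq_rep(1) by (fastforce simp: coeq_sset_def)
    then have "act Y l n (delta_comp l g f) x = act Y l m f (act Y m n g x)"
      using Y f g by (simp add: simplicial_set_def)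
    then show "act (coeq_sset R s t Y) l n (delta_comp l g f) x =
        act (coeq_sset R s t Y) l m f (act (coeq_sset R s t Y) m n g x)"
      using nat[OF f cl[OF g x]] by (simp add: coeq_sset_def)
  qed
  show "simplicial_map Y (coeq_sset R s t Y) ?c"
    using nat by (auto simp: simplicial_map_def coeq_sset_def)
  show "smap_eq R (?c \<odot> s) (?c \<odot> t)"
    using coeq_rep_eq[OF coeq_rel_gen] by (auto simp: smap_eq_def smap_comp_def)
qed

lemma coequalizer_wrtI:
  assumes Y: "simplicial_set Y" and Q: "simplicial_set Q" and q: "simplicial_map Y Q q"
    and st: "simplicial_map R Y s" "simplicial_map R Y t"
    and surj: "\<And>n. q n ` simplices Y n = simplices Q n"
    and ker: "\<And>n x y. x \<in> simplices Y n \<Longrightarrow> y \<in> simplices Y n \<Longrightarrow>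
      q n x = q n y \<longleftrightarrow> (x, y) \<in> coeq_rel R s t n"
  shows "coequalizer_wrt TYPE('d) R Y s t Q q"
  unfolding coequalizer_wrt_def
proof (intro conjI allI impI)
  show "smap_eq R (q \<odot> s) (q \<odot> t)"
    unfolding smap_eq_def smap_comp_def comp_apply
  proof (intro allI ballI)
    fix n r assume r: "r \<in> simplices R n"
    then have "s n r \<in> simplices Y n" "t n r \<in> simplices Y n"
      using st by (auto simp: simplicial_map_def)
    then show "q n (s n r) = q n (t n r)" using ker coeq_rel_gen[OF r] by simp
  qed
next
  fix Z :: "'d sset" and g
  assume "simplicial_set Z \<and> simplicial_map Y Z g \<and> smap_eq R (g \<odot> s) (g \<odot> t)"
  then have g: "simplicial_map Y Z g" and gst: "smap_eq R (g \<odot> s) (g \<odot> t)" by auto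
  define h where "h n z = g n (SOME y. y \<in> simplices Y n \<and> q n y = z)" for n z
  have hq: "h n (q n x) = g n x" if x: "x \<in> simplices Y n" for n x
  proof -
    define y where "y = (SOME y. y \<in> simplices Y n \<and> q n y = q n x)"
    have "y \<in> simplices Y n \<and> q n y = q n x"
      unfolding y_def by (rule someI[of _ x]) (use x in auto)
    then have "(y, x) \<in> coeq_rel R s t n" using ker x by auto
    then have "g n y = g n x"
      using gst by (induction rule: coeq_rel_induct) (auto simp: smap_eq_def smap_comp_def)
    then show ?thesis by (simp add: h_def y_def)
  qed
  have "simplicial_map Q Z h"
    unfolding simplicial_map_def
  proof (intro conjI allI ballI)
    fix n show "h n \<in> simplices Q n \<rightarrow> simplices Z n"
      using g hq surj[of n, symmetric] by (auto simp: simplicial_map_def Pi_iff)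
  next
    fix m n f z assume f: "f \<in> delta_hom m n" and "z \<in> simplices Q n"
    then obtain y where y: "y \<in> simplices Y n" "z = q n y" using surj by blast
    have fy: "act Y m n f y \<in> simplices Y m" using Y f y by (auto simp: simplicial_set_def)
    have "act Q m n f z = q m (act Y m n f y)" using q f y by (simp add: simplicial_map_def)
    then show "h m (act Q m n f z) = act Z m n f (h n z)"
      using hq[OF fy] hq[OF y(1)] y g f by (simp add: simplicial_map_def)
  qed
  moreover have "smap_eq Q h' h" if "smap_eq Y (h' \<odot> q) g" for h'
    using that hq surj unfolding smap_eq_def smap_comp_def by (metis comp_apply imageE)
  ultimately show "\<exists>h. simplicial_map Q Z h \<and> smap_eq Y (h \<odot> q) g \<and>
      (\<forall>h'. simplicial_map Q Z h' \<and> smap_eq Y (h' \<odot> q) g \<longrightarrow> smap_eq Q h' h)"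
    using hq by (intro exI[of _ h]) (auto simp: smap_eq_def smap_comp_def)
qed (use Q q in auto)

lemma is_coequalizer_coeq_sset:
  assumes "simplicial_set Y" "simplicial_set R" "simplicial_map R Y s" "simplicial_map R Y t"
  shows "is_coequalizer R Y s t (coeq_sset R s t Y) (coeq_rep R s t Y)"
  unfolding is_coequalizer_def
  using coeq_sset[OF assms] assms
  by (intro coequalizer_wrtI) (auto simp: coeq_rep_eq_iff coeq_sset_def)

definition sset_map :: "('a \<Rightarrow> 'b) \<Rightarrow> 'a sset \<Rightarrow> 'b sset" where
  "sset_map j X = \<lparr>simplices = (\<lambda>n. j ` simplices X n), act = (\<lambda>m n f. j \<circ> act X m n f \<circ> inv j)\<rparr>"

lemma sset_map:
  assumes j: "inj j" and X: "simplicial_set X"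
  shows "simplicial_set (sset_map j X)" "simplicial_map X (sset_map j X) (\<lambda>n. j)"
proof -
  note [simp] = inv_f_f[OF j]
  show "simplicial_set (sset_map j X)" "simplicial_map X (sset_map j X) (\<lambda>n. j)"
    using X unfolding simplicial_set_def simplicial_map_def sset_map_def by (auto simp: Pi_iff)
qed

lemma simplicial_map_comp:
  "simplicial_map X Y p \<Longrightarrow> simplicial_map Y Z q \<Longrightarrow> simplicial_map X Z (q \<odot> p)"
  by (auto simp: simplicial_map_def smap_comp_def Pi_iff)

lemma is_coequalizer_surj_ker:
  fixes Y :: "'a sset" and Q :: "'c sset"
  assumes Y: "simplicial_set Y" and R: "simplicial_set R"
    and s: "simplicial_map R Y s" and t: "simplicial_map R Y t"
    and co: "is_coequalizer R Y s t Q q"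
  shows "\<And>n. q n ` simplices Y n = simplices Q n"
    and "\<And>n x y. x \<in> simplices Y n \<Longrightarrow> y \<in> simplices Y n \<Longrightarrow>
      q n x = q n y \<longleftrightarrow> (x, y) \<in> coeq_rel R s t n"
proof -
  have Q: "simplicial_set Q" and q: "simplicial_map Y Q q"
    and qst: "smap_eq R (q \<odot> s) (q \<odot> t)"
    using co by (auto simp: is_coequalizer_def coequalizer_wrt_def)
  have univ: "\<exists>h. simplicial_map Q Z h \<and> smap_eq Y (h \<odot> q) g \<and>
      (\<forall>h'. simplicial_map Q Z h' \<and> smap_eq Y (h' \<odot> q) g \<longrightarrow> smap_eq Q h' h)"
    if "simplicial_set Z" "simplicial_map Y Z g" "smap_eq R (g \<odot> s) (g \<odot> t)"
    for Z :: "('a + 'c) sset" and g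
    using co that unfolding is_coequalizer_def coequalizer_wrt_def by blast
  show "q n x = q n y \<longleftrightarrow> (x, y) \<in> coeq_rel R s t n"
    if x: "x \<in> simplices Y n" and y: "y \<in> simplices Y n" for n x y
  proof
    assume "(x, y) \<in> coeq_rel R s t n"
    then show "q n x = q n y"
      using qst by (induction rule: coeq_rel_induct) (auto simp: smap_eq_def smap_comp_def)
  next
    assume eq: "q n x = q n y"
    let ?C = "coeq_sset R s t Y" and ?c = "coeq_rep R s t Y"
    note C = coeq_sset[OF Y R s t]
    have "\<exists>h. simplicial_map Q (sset_map Inl ?C) h \<and> smap_eq Y (h \<odot> q) ((\<lambda>n. Inl) \<odot> ?c) \<and>
        (\<forall>h'. simplicial_map Q (sset_map Inl ?C) h' \<and> smap_eq Y (h' \<odot> q) ((\<lambda>n. Inl) \<odot> ?c) \<longrightarrow>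
          smap_eq Q h' (h :: nat \<Rightarrow> 'c \<Rightarrow> 'a + 'c))"
      using C(3) by (intro univ sset_map simplicial_map_comp[OF C(2)] C(1) inj_Inl)
        (auto simp: smap_eq_def smap_comp_def)
    then obtain h :: "nat \<Rightarrow> 'c \<Rightarrow> 'a + 'c" where "smap_eq Y (h \<odot> q) ((\<lambda>n. Inl) \<odot> ?c)" by blast
    then have "h n (q n x) = Inl (?c n x)" "h n (q n y) = Inl (?c n y)"
      using x y by (auto simp: smap_eq_def smap_comp_def)
    then have "?c n x = ?c n y" using eq by simp
    then show "(x, y) \<in> coeq_rel R s t n" using coeq_rep_eq_iff x y by metis
  qed
  show "q n ` simplices Y n = simplices Q n" for n
  proof
    show "q n ` simplices Y n \<subseteq> simplices Q n" using q by (auto simp: simplicial_map_def)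
    define I where "I = Q\<lparr>simplices := \<lambda>n. q n ` simplices Y n\<rparr>"
    have IQ: "simplices I m \<subseteq> simplices Q m" for m
      using q by (auto simp: simplicial_map_def I_def)
    have qact: "act Q m n f (q n y) \<in> q m ` simplices Y m"
      if "f \<in> delta_hom m n" "y \<in> simplices Y n" for m n f y
    proof -
      have "act Q m n f (q n y) = q m (act Y m n f y)"
        using q that by (simp add: simplicial_map_def)
      moreover have "act Y m n f y \<in> simplices Y m"
        using Y that by (auto simp: simplicial_set_def)
      ultimately show ?thesis by simp
    qed
    have I: "simplicial_set I"
      unfolding simplicial_set_def
    proof (intro conjI allI ballI)
      fix m n f assume "f \<in> delta_hom m n"
      then show "act I m n f \<in> simplices I n \<rightarrow> simplices I m" using qact by (auto simp: I_def)
    next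
      fix n x assume "x \<in> simplices I n"
      then have "x \<in> simplices Q n" using IQ by blast
      then show "act I n n (delta_id n) x = x"
        using Q by (simp add: simplicial_set_def I_def)
    next
      fix l m n f g x
      assume "f \<in> delta_hom l m" "g \<in> delta_hom m n" "x \<in> simplices I n"
      moreover from this have "x \<in> simplices Q n" using IQ by blast
      ultimately show "act I l n (delta_comp l g f) x = act I l m f (act I m n g x)"
        using Q by (simp add: simplicial_set_def I_def)
    qed
    have qI: "simplicial_map Y I q" using q by (auto simp: simplicial_map_def I_def)
    have Inr: "simplicial_map I (sset_map (Inr :: 'c \<Rightarrow> 'a + 'c) I) (\<lambda>n. Inr)"
      "simplicial_map Q (sset_map (Inr :: 'c \<Rightarrow> 'a + 'c) Q) (\<lambda>n. Inr)"
      using sset_map(2)[OF inj_Inr] I Q by auto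
    have sub: "simplicial_map Q (sset_map Inr Q) h" if "simplicial_map Q (sset_map Inr I) h"
      for h :: "nat \<Rightarrow> 'c \<Rightarrow> 'a + 'c"
      using that IQ unfolding simplicial_map_def sset_map_def I_def by (simp add: Pi_iff) blast
    have e: "smap_eq R (((\<lambda>n. Inr) \<odot> q) \<odot> s) (((\<lambda>n. Inr :: 'c \<Rightarrow> 'a + 'c) \<odot> q) \<odot> t)"
      using qst by (auto simp: smap_eq_def smap_comp_def)
    obtain h where h: "simplicial_map Q (sset_map (Inr :: 'c \<Rightarrow> 'a + 'c) I) h"
      "smap_eq Y (h \<odot> q) ((\<lambda>n. Inr) \<odot> q)"
      using univ[OF sset_map(1)[OF inj_Inr I] simplicial_map_comp[OF qI Inr(1)] e] by blast
    obtain h0 where h0: "\<And>h'. simplicial_map Q (sset_map (Inr :: 'c \<Rightarrow> 'a + 'c) Q) h' \<Longrightarrow>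
        smap_eq Y (h' \<odot> q) ((\<lambda>n. Inr) \<odot> q) \<Longrightarrow> smap_eq Q h' h0"
      using univ[OF sset_map(1)[OF inj_Inr Q] simplicial_map_comp[OF q Inr(2)] e] by blast
    have "smap_eq Y ((\<lambda>n. Inr :: 'c \<Rightarrow> 'a + 'c) \<odot> q) ((\<lambda>n. Inr) \<odot> q)"
      by (simp add: smap_eq_def)
    then have "smap_eq Q (\<lambda>n. Inr) h0" "smap_eq Q h h0"
      using h0 sub h Inr(2) by blast+
    then have "h n z = Inr z" if "z \<in> simplices Q n" for z
      using that by (auto simp: smap_eq_def)
    moreover have "h n z \<in> Inr ` q n ` simplices Y n" if "z \<in> simplices Q n" for z
      using h(1) that by (auto simp: simplicial_map_def sset_map_def I_def Pi_iff)
    ultimately show "simplices Q n \<subseteq> q n ` simplices Y n" by fastforce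
  qed
qed

lemma is_coequalizer_any:
  assumes "simplicial_set Y" "simplicial_set R" "simplicial_map R Y s" "simplicial_map R Y t"
    and co: "is_coequalizer R Y s t Q q"
  shows "coequalizer_wrt TYPE('d) R Y s t Q q"
  using co is_coequalizer_surj_ker[OF assms] assms(1,3,4)
  by (intro coequalizer_wrtI) (auto simp: is_coequalizer_def coequalizer_wrt_def)

end

theory Submission
  imports Defs "HOL-Library.Infinite_Set"
begin

text \<open>
  A horn collapses onto its vertex \<open>k\<close>: remove the pairs of faces \<open>T\<close>, \<open>T \<union> {k}\<close> with \<open>k \<notin> T\<close>,
  maximal \<open>T\<close> first; undoing each removal fills a horn. So a horn in the base of a Kan fibration lifts as soon as
  its vertex \<open>k\<close> lifts. Given a lifting problem \<open>(u, v)\<close> for the quotient map, choose a simplex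
  \<open>v'\<close> of \<open>Y\<close> over \<open>v\<close>. The horn \<open>(u, v')\<close> in \<open>Y \<times> Y\<close> has its vertex \<open>k\<close> in the image of \<open>R\<close>,
  hence lifts to \<open>R\<close>; extending \<open>u\<close> to a simplex \<open>w\<close> of \<open>Y\<close> and then the lift to a simplex of \<open>R\<close>
  over \<open>(w, v')\<close> shows that \<open>w\<close> lies over \<open>v\<close>. A horn in \<open>Y/R\<close> lifts to \<open>Y\<close> by the same principle
  and is filled there.
\<close>

section \<open>Calculus of monotone maps and simplicial maps\<close>

lemma delta_comp_in_delta_hom:
  "f \<in> delta_hom l m \<Longrightarrow> g \<in> delta_hom m n \<Longrightarrow> delta_comp l g f \<in> delta_hom l n"
  by (auto simp: delta_hom_def delta_comp_def compose_def mono_on_def PiE_iff)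

lemma delta_comp_assoc:
  "f \<in> delta_hom l m \<Longrightarrow>
    delta_comp l (delta_comp m h g) f = delta_comp l h (delta_comp l g f)"
  by (auto simp: delta_hom_def delta_comp_def compose_def PiE_iff fun_eq_iff)

lemma delta_comp_image: "delta_comp m g f ` {..m} = g ` f ` {..m}"
  by (force simp: delta_comp_def compose_def)

lemma delta_comp_image_subset: "f \<in> delta_hom l m \<Longrightarrow> delta_comp l g f ` {..l} \<subseteq> g ` {..m}"
  by (auto simp: delta_comp_image delta_hom_def)

lemma delta_id_in_delta_hom [simp]: "delta_id n \<in> delta_hom n n"
  by (auto simp: delta_hom_def delta_id_def mono_on_def)

lemma delta_comp_id_left: "f \<in> delta_hom m n \<Longrightarrow> delta_comp m (delta_id n) f = f"
  by (force simp: delta_hom_def delta_comp_def delta_id_def compose_def PiE_iff fun_eq_iff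
      extensional_def)

lemma delta_const_in_delta_hom: "k \<le> n \<Longrightarrow> restrict (\<lambda>_. k) {..m} \<in> delta_hom m n"
  by (auto simp: delta_hom_def mono_on_def)

text \<open>The cone with apex \<open>k\<close> over the subcomplex of the opposite face with set of faces \<open>F\<close>;
  the apex itself belongs to it iff \<open>{} \<in> F\<close>.\<close>

definition cone_complex :: "nat \<Rightarrow> nat \<Rightarrow> nat set set \<Rightarrow> (nat \<Rightarrow> nat) sset" where
  "cone_complex n k F =
    \<lparr>simplices = (\<lambda>m. {x \<in> delta_hom m n. x ` {..m} - {k} \<in> F}), act = act (std_simplex n)\<rparr>"

lemma simplicial_map_closed:
  "simplicial_map X Y p \<Longrightarrow> x \<in> simplices X n \<Longrightarrow> p n x \<in> simplices Y n"
  by (auto simp: simplicial_map_def)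

lemma simplicial_map_act:
  "simplicial_map X Y p \<Longrightarrow> f \<in> delta_hom m n \<Longrightarrow> x \<in> simplices X n \<Longrightarrow>
    p m (act X m n f x) = act Y m n f (p n x)"
  by (auto simp: simplicial_map_def)

lemma simplicial_set_closed:
  "simplicial_set X \<Longrightarrow> f \<in> delta_hom m n \<Longrightarrow> x \<in> simplices X n \<Longrightarrow> act X m n f x \<in> simplices X m"
  by (auto simp: simplicial_set_def)

section \<open>Horns as cones, and the filling of horns\<close>

text \<open>A simplex misses a vertex other than \<open>k\<close> exactly when its vertices other
  than \<open>k\<close> form a proper subset of \<open>{..n} - {k}\<close>. In cone form one set
  \<open>T\<close> stands for the pair of faces \<open>T\<close>, \<open>T \<union> {k}\<close>, so
  a collapse removes a single member of the index family.\<close>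

lemma horn_eq_cone_complex:
  assumes "k \<le> n"
  shows "horn n k = cone_complex n k {T. T \<subset> {..n} - {k}}"
proof -
  have "(\<exists>j\<le>n. j \<noteq> k \<and> j \<notin> x ` {..m}) \<longleftrightarrow> x ` {..m} - {k} \<subset> {..n} - {k}"
    if "x \<in> delta_hom m n" for x m
  proof -
    have "x ` {..m} \<subseteq> {..n}" using that by (auto simp: delta_hom_def)
    then show ?thesis by auto
  qed
  then show ?thesis by (simp add: horn_def cone_complex_def fun_eq_iff cong: conj_cong)
qed

lemma cone_complex_act:
  "act (cone_complex n k F) l m f x = delta_comp l x f"
  by (simp add: cone_complex_def std_simplex_def)

lemma horn_act: "act (horn n k) l m f x = delta_comp l x f"
  by (simp add: horn_def std_simplex_def)

lemma std_simplex_act: "act (std_simplex n) l m f x = delta_comp l x f"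
  by (simp add: std_simplex_def)

lemma horn_subset_std_simplex: "simplices (horn n k) m \<subseteq> simplices (std_simplex n) m"
  by (auto simp: horn_def std_simplex_def)

lemma simplicial_map_horn:
  "simplicial_map (std_simplex n) X w \<Longrightarrow> simplicial_map (horn n k) X w"
  using horn_subset_std_simplex[of n k]
  by (fastforce simp: simplicial_map_def horn_act std_simplex_act)

lemma kan_fibrationD:
  assumes "kan_fibration X Y p" "1 \<le> n" "k \<le> n"
    and "simplicial_map (horn n k) X u" "simplicial_map (std_simplex n) Y v"
    and "\<And>m x. x \<in> simplices (horn n k) m \<Longrightarrow> p m (u m x) = v m x"
  obtains w where "simplicial_map (std_simplex n) X w"
    "\<And>m x. x \<in> simplices (horn n k) m \<Longrightarrow> w m x = u m x"
    "\<And>m x. x \<in> delta_hom m n \<Longrightarrow> p m (w m x) = v m x"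
proof -
  have "smap_eq (horn n k) (p \<odot> u) v" using assms(6) by (auto simp: smap_eq_def smap_comp_def)
  then obtain w where "simplicial_map (std_simplex n) X w \<and>
        smap_eq (horn n k) w u \<and> smap_eq (std_simplex n) (p \<odot> w) v"
    using assms unfolding kan_fibration_def by blast
  then show ?thesis
    by (intro that[of w]) (auto simp: smap_eq_def smap_comp_def std_simplex_def)
qed

section \<open>Lifting along the collapse of a horn onto its vertex\<close>

text \<open>Every proper subset of \<open>T\<close> lies in \<open>F\<close> and \<open>T\<close>
  does not, so the face on \<open>T \<union> {k}\<close> meets the old cone exactly in its horn at
  \<open>k\<close>. A filler of that horn over \<open>u\<close> is glued to
  \<open>w\<close>.\<close>

lemma cone_complex_lift_step:
  fixes w :: "(nat \<Rightarrow> nat, 'x) smap"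
  assumes p: "kan_fibration X B p" and k: "k \<le> n"
    and T: "T \<subseteq> {..n} - {k}" "T \<noteq> {}" "T \<notin> F"
    and boundary: "\<And>T'. T' \<subset> T \<Longrightarrow> T' \<in> F"
    and closed: "\<And>A A'. A \<in> F \<Longrightarrow> A' \<subseteq> A \<Longrightarrow> A' \<in> F"
    and u: "simplicial_map (cone_complex n k (insert T F)) B u"
    and w: "simplicial_map (cone_complex n k F) X w"
    and pw: "\<And>m x. x \<in> simplices (cone_complex n k F) m \<Longrightarrow> p m (w m x) = u m x"
  shows "\<exists>w'. simplicial_map (cone_complex n k (insert T F)) X w' \<and>
    (\<forall>m. \<forall>x \<in> simplices (cone_complex n k (insert T F)) m. p m (w' m x) = u m x)"
proof -
  define S where "S = insert k T"
  define d where "d = card T"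
  have finT: "finite T" using T(1) finite_subset by blast
  have d: "1 \<le> d" using T(2) finT by (simp add: d_def card_gt_0_iff Suc_le_eq)
  have kT: "k \<notin> T" using T(1) by auto
  have S: "S \<subseteq> {..n}" "finite S" "{..<card S} = {..d}"
    using T(1) k finT kT by (auto simp: S_def d_def)
  \<comment> \<open>The increasing enumeration \<open>e\<close> identifies the standard
    \<open>d\<close>-simplex with the face \<open>S\<close>, which has \<open>d + 1\<close>
    vertices; \<open>r\<close> is its inverse, and \<open>a\<close> below is the position of the
    apex \<open>k\<close> in \<open>S\<close>.\<close>
  obtain e where e: "bij_betw e {..d} S" "strict_mono_on {..d} e"
    using ex_bij_betw_strict_mono_card[OF S(2)] S(3) by metis
  define r where "r = inv_into {..d} e"
  have er: "e (r i) = i" "r i \<le> d" if "i \<in> S" for i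
    using e(1) that bij_betw_inv_into_right[OF e(1) that] bij_betwE[OF bij_betw_inv_into[OF e(1)]]
    by (auto simp: r_def)
  have re: "r (e i) = i" "e i \<in> S" if "i \<le> d" for i
    using bij_betw_inv_into_left[OF e(1)] bij_betwE[OF e(1)] that by (auto simp: r_def)
  define a where "a = r k"
  have a: "a \<le> d" "e a = k" using er[of k] by (auto simp: a_def S_def)
  have e_mono: "e i \<le> e j" if "i \<le> j" "j \<le> d" for i j
    using strict_mono_on_leD[OF e(2)] that by auto
  have r_mono: "r i \<le> r j" if "i \<le> j" "i \<in> S" "j \<in> S" for i j
    using er(1)[OF that(2)] er(1)[OF that(3)] er(2)[OF that(2)] er(2)[OF that(3)] that(1)
      strict_mono_onD[OF e(2), of "r j" "r i"] by force
  have e_hom: "delta_comp m e x \<in> delta_hom m n" "delta_comp m e x ` {..m} \<subseteq> S"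
    if "x \<in> delta_hom m d" for x m
  proof -
    have "x i \<le> d" if "i \<le> m" for i using \<open>x \<in> delta_hom m d\<close> that by (auto simp: delta_hom_def)
    then show "delta_comp m e x \<in> delta_hom m n" "delta_comp m e x ` {..m} \<subseteq> S"
      using that S(1) re(2) e_mono
      by (auto simp: delta_hom_def delta_comp_def compose_def mono_on_def PiE_iff subset_iff)
  qed
  have r_hom: "delta_comp m r x \<in> delta_hom m d" "delta_comp m e (delta_comp m r x) = x"
    if "x \<in> delta_hom m n" "x ` {..m} \<subseteq> S" for x m
  proof -
    have xS: "x i \<in> S" if "i \<le> m" for i using \<open>x ` {..m} \<subseteq> S\<close> that by auto
    then show "delta_comp m r x \<in> delta_hom m d"
      using that er r_mono by (auto simp: delta_hom_def delta_comp_def compose_def mono_on_def)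
    show "delta_comp m e (delta_comp m r x) = x"
      using that er xS
      by (force simp: delta_hom_def delta_comp_def compose_def fun_eq_iff PiE_iff extensional_def)
  qed
  have face: "A - {k} \<subset> T" if "A \<subseteq> S" "j \<in> T" "j \<notin> A" for A j
    using that by (auto simp: S_def)
  \<comment> \<open>A face of the \<open>d\<close>-simplex opposite to some
    \<open>j \<noteq> a\<close> omits \<open>e j\<close>, which lies in \<open>T\<close>. Its
    vertices other than \<open>k\<close> thus form a proper subset of \<open>T\<close>, hence a
    member of \<open>F\<close>.\<close>
  have horn_cone: "delta_comp m e x \<in> simplices (cone_complex n k F) m"
    if x: "x \<in> simplices (horn d a) m" for x m
  proof -
    obtain j where j: "x \<in> delta_hom m d" "j \<le> d" "j \<noteq> a" "j \<notin> x ` {..m}"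
      using x by (auto simp: horn_def)
    have "e j \<in> T" using re[OF j(2)] j(3) by (auto simp: S_def a_def)
    moreover have "e j \<notin> delta_comp m e x ` {..m}"
    proof
      assume "e j \<in> delta_comp m e x ` {..m}"
      then obtain i where i: "i \<le> m" "e j = e (x i)" by (auto simp: delta_comp_image)
      moreover have "x i \<le> d" using j(1) i(1) by (auto simp: delta_hom_def)
      ultimately have "j = x i" using re(1) j(2) by metis
      then show False using j(4) i(1) by auto
    qed
    ultimately show ?thesis
      using boundary face e_hom[OF j(1)] by (auto simp: cone_complex_def)
  qed
  have std_cone: "delta_comp m e x \<in> simplices (cone_complex n k (insert T F)) m"
    if x: "x \<in> delta_hom m d" for x m
  proof -
    have "delta_comp m e x ` {..m} - {k} \<subseteq> T" using e_hom(2)[OF x] by (auto simp: S_def)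
    then show ?thesis using boundary e_hom(1)[OF x] by (auto simp: cone_complex_def)
  qed
  have "simplicial_map (horn d a) X (\<lambda>m x. w m (delta_comp m e x))"
    unfolding simplicial_map_def
  proof (intro conjI allI ballI)
    fix l m f x assume f: "f \<in> delta_hom l m" and x: "x \<in> simplices (horn d a) m"
    show "w l (delta_comp l e (act (horn d a) l m f x)) = act X l m f (w m (delta_comp m e x))"
      using simplicial_map_act[OF w f horn_cone[OF x]] f
      by (simp add: horn_act cone_complex_act delta_comp_assoc)
  qed (use horn_cone simplicial_map_closed[OF w] in auto)
  moreover have "simplicial_map (std_simplex d) B (\<lambda>m x. u m (delta_comp m e x))"
    unfolding simplicial_map_def
  proof (intro conjI allI ballI)
    fix l m f x assume f: "f \<in> delta_hom l m" and "x \<in> simplices (std_simplex d) m"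
    then have x: "x \<in> delta_hom m d" by (simp add: std_simplex_def)
    show "u l (delta_comp l e (act (std_simplex d) l m f x)) = act B l m f (u m (delta_comp m e x))"
      using simplicial_map_act[OF u f std_cone[OF x]] f
      by (simp add: std_simplex_act cone_complex_act delta_comp_assoc)
  qed (use std_cone simplicial_map_closed[OF u] in \<open>auto simp: std_simplex_def\<close>)
  ultimately obtain z where z: "simplicial_map (std_simplex d) X z"
    and zw: "\<And>m x. x \<in> simplices (horn d a) m \<Longrightarrow> z m x = w m (delta_comp m e x)"
    and pz: "\<And>m x. x \<in> delta_hom m d \<Longrightarrow> p m (z m x) = u m (delta_comp m e x)"
    by (rule kan_fibrationD[OF p d a(1)]) (use pw horn_cone in auto)
  \<comment> \<open>The filler is used only on the new simplices; since \<open>T \<notin> F\<close>,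
    the old lift stays untouched on the old cone.\<close>
  define w' where
    "w' m x = (if x ` {..m} - {k} = T then z m (delta_comp m r x) else w m x)" for m x
  \<comment> \<open>The filler agrees with \<open>w\<close> on the horn, so its formula holds on the
    whole face \<open>S\<close>. This gives naturality where a face of a new simplex falls into the
    old cone.\<close>
  have w'_z: "w' m x = z m (delta_comp m r x)"
    if x: "x \<in> delta_hom m n" "x ` {..m} \<subseteq> S" for m x
  proof (cases "x ` {..m} - {k} = T")
    case False
    then obtain j where j: "j \<in> T" "j \<notin> x ` {..m}" using x(2) kT by (auto simp: S_def)
    have "r j \<notin> delta_comp m r x ` {..m}"
    proof
      assume "r j \<in> delta_comp m r x ` {..m}"
      then obtain i where i: "i \<le> m" "r j = r (x i)" by (auto simp: delta_comp_image)
      then have "j = x i" using er(1) j(1) x(2) by (metis S_def atMost_iff image_subset_iff insertCI)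
      then show False using i(1) j(2) by auto
    qed
    moreover have "r j \<le> d" "r j \<noteq> a" using er j(1) kT a by (auto simp: S_def)
    ultimately have "delta_comp m r x \<in> simplices (horn d a) m"
      using r_hom(1)[OF x] by (auto simp: horn_def)
    then show ?thesis using False zw r_hom(2)[OF x] by (simp add: w'_def)
  qed (simp add: w'_def)
  \<comment> \<open>The new cone is the union of the face \<open>S\<close> and the old cone. Both
    are closed under the simplicial action, so naturality is checked on each of them
    separately.\<close>
  have cases: "(x \<in> delta_hom m n \<and> x ` {..m} \<subseteq> S \<and> w' m x = z m (delta_comp m r x)) \<or>
      (x \<in> simplices (cone_complex n k F) m \<and> w' m x = w m x)"
    if "x \<in> simplices (cone_complex n k (insert T F)) m" for x m
    using that T(3) by (auto simp: cone_complex_def w'_def S_def)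
  have "simplicial_map (cone_complex n k (insert T F)) X w'"
    unfolding simplicial_map_def
  proof (intro conjI allI ballI funcsetI)
    fix m x assume "x \<in> simplices (cone_complex n k (insert T F)) m"
    from cases[OF this] show "w' m x \<in> simplices X m"
      using simplicial_map_closed[OF z] simplicial_map_closed[OF w] r_hom
      by (auto simp: std_simplex_def)
  next
    fix l m f x assume f: "f \<in> delta_hom l m"
      and "x \<in> simplices (cone_complex n k (insert T F)) m"
    from cases[OF this(2)]
    show "w' l (act (cone_complex n k (insert T F)) l m f x) = act X l m f (w' m x)"
    proof (elim disjE conjE)
      assume x: "x \<in> delta_hom m n" "x ` {..m} \<subseteq> S" and "w' m x = z m (delta_comp m r x)"
      moreover have "delta_comp l x f \<in> delta_hom l n" "delta_comp l x f ` {..l} \<subseteq> S"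
        using delta_comp_in_delta_hom[OF f x(1)] delta_comp_image_subset[OF f, of x] x(2) by auto
      ultimately show ?thesis
        using w'_z simplicial_map_act[OF z f, of "delta_comp m r x"] r_hom(1)[OF x] f
        by (simp add: std_simplex_def cone_complex_act delta_comp_assoc)
    next
      assume x: "x \<in> simplices (cone_complex n k F) m" and "w' m x = w m x"
      moreover have "delta_comp l x f ` {..l} - {k} \<in> F"
        using x by (intro closed[OF _ Diff_mono[OF delta_comp_image_subset[OF f] subset_refl]])
          (simp add: cone_complex_def)
      then have "w' l (delta_comp l x f) = w l (delta_comp l x f)"
        using T(3) by (auto simp: w'_def)
      ultimately show ?thesis
        using simplicial_map_act[OF w f x] by (simp add: cone_complex_act)
    qed
  qed
  moreover have "p m (w' m x) = u m x"
    if "x \<in> simplices (cone_complex n k (insert T F)) m" for m x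
    using cases[OF that] pz r_hom pw by auto
  ultimately show ?thesis by blast
qed

text \<open>This cone is the single vertex \<open>k\<close> with its degeneracies, so
  \<open>u\<close> is determined by its value there, and the degeneracies of \<open>r\<close>
  provide the lift.\<close>

lemma cone_complex_lift_apex:
  assumes X: "simplicial_set X" and p: "simplicial_map X B p" and k: "k \<le> n"
    and u: "simplicial_map (cone_complex n k {{}}) B u"
    and r: "r \<in> simplices X 0" "p 0 r = u 0 (restrict (\<lambda>_. k) {..0})"
  shows "\<exists>w. simplicial_map (cone_complex n k {{}}) X w \<and>
    (\<forall>m. \<forall>x \<in> simplices (cone_complex n k {{}}) m. p m (w m x) = u m x)"
proof -
  let ?C = "cone_complex n k {{}}"
  define c where "c m = restrict (\<lambda>_. 0 :: nat) {..m}" for m :: nat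
  let ?v = "restrict (\<lambda>_. k) {..0::nat}"
  define w where "w m (x :: nat \<Rightarrow> nat) = act X m 0 (c m) r" for m x
  have c: "c m \<in> delta_hom m 0" for m by (simp add: c_def delta_const_in_delta_hom)
  have v: "?v \<in> simplices ?C 0"
    using delta_const_in_delta_hom[OF k, of 0] by (auto simp: cone_complex_def)
  have "simplicial_map ?C X w"
    unfolding simplicial_map_def
  proof (intro conjI allI ballI funcsetI)
    fix l m f x assume f: "f \<in> delta_hom l m"
    have "delta_comp l (c m) f = c l"
      using f by (auto simp: c_def delta_comp_def compose_def delta_hom_def fun_eq_iff)
    then show "w l (act ?C l m f x) = act X l m f (w m x)"
      using X f c r(1) unfolding simplicial_set_def w_def by metis
  qed (use X c r(1) in \<open>auto simp: w_def simplicial_set_closed\<close>)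
  moreover have "p m (w m x) = u m x" if x: "x \<in> simplices ?C m" for m x
  proof -
    have "x = delta_comp m ?v (c m)"
      using x by (auto simp: cone_complex_def delta_comp_def compose_def c_def delta_hom_def
          fun_eq_iff PiE_iff extensional_def)
    moreover have "p m (w m x) = act B m 0 (c m) (u 0 ?v)"
      using simplicial_map_act[OF p c r(1)] r(2) by (simp add: w_def)
    ultimately show ?thesis
      using simplicial_map_act[OF u c v] by (simp add: cone_complex_act)
  qed
  ultimately show ?thesis by blast
qed

text \<open>Induction on the number of sets in \<open>F\<close>: the lift on the apex starts it, and
  each further set is restored by one horn filling.\<close>

lemma cone_complex_lift:
  assumes X: "simplicial_set X" and p: "kan_fibration X B p" and k: "k \<le> n"
    and F: "finite F" "{} \<in> F" "F \<subseteq> Pow ({..n} - {k})"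
    and closed: "\<And>A A'. A \<in> F \<Longrightarrow> A' \<subseteq> A \<Longrightarrow> A' \<in> F"
    and u: "simplicial_map (cone_complex n k F) B u"
    and r: "r \<in> simplices X 0" "p 0 r = u 0 (restrict (\<lambda>_. k) {..0})"
  shows "\<exists>w. simplicial_map (cone_complex n k F) X w \<and>
    (\<forall>m. \<forall>x \<in> simplices (cone_complex n k F) m. p m (w m x) = u m x)"
  using F closed u
proof (induction "card F" arbitrary: F rule: less_induct)
  case less
  show ?case
  proof (cases "F = {{}}")
    case True
    have "simplicial_map X B p" using p by (simp add: kan_fibration_def)
    moreover have "simplicial_map (cone_complex n k {{}}) B u" using less.prems(5) True by simp
    ultimately show ?thesis
      unfolding True by (rule cone_complex_lift_apex[OF X _ k]) (use r in auto)
  next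
    case False
    \<comment> \<open>Maximality of \<open>T\<close> keeps the family downward closed after its
      removal. Also \<open>T\<close> is nonempty: if \<open>{}\<close> were maximal,
      \<open>F\<close> would be \<open>{{}}\<close>.\<close>
    obtain T where T: "T \<in> F" "\<And>A. A \<in> F \<Longrightarrow> T \<subseteq> A \<Longrightarrow> A = T"
      using finite_has_maximal[OF less.prems(1)] less.prems(2) by blast
    let ?G = "F - {T}"
    have TF: "insert T ?G = F" and "T \<noteq> {}" using T less.prems(2) False by auto
    have G_closed: "A' \<in> ?G" if "A \<in> ?G" "A' \<subseteq> A" for A A'
      using that less.prems(4) T(2) by blast
    have "simplicial_map (cone_complex n k ?G) B u"
      using less.prems(5) by (auto simp: simplicial_map_def cone_complex_def)
    moreover have "card ?G < card F" using less.prems(1) T(1) by (intro card_Diff1_less)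
    ultimately obtain w where w: "simplicial_map (cone_complex n k ?G) X w"
      "\<And>m x. x \<in> simplices (cone_complex n k ?G) m \<Longrightarrow> p m (w m x) = u m x"
      using less.hyps[of ?G] G_closed less.prems(1-3) \<open>T \<noteq> {}\<close> by blast
    have "\<exists>w. simplicial_map (cone_complex n k (insert T ?G)) X w \<and>
      (\<forall>m. \<forall>x \<in> simplices (cone_complex n k (insert T ?G)) m. p m (w m x) = u m x)"
    proof (rule cone_complex_lift_step[OF p k _ \<open>T \<noteq> {}\<close> _ _ G_closed _ w])
      show "T \<subseteq> {..n} - {k}" using less.prems(3) T(1) by auto
      show "T' \<in> ?G" if "T' \<subset> T" for T' using less.prems(4)[OF T(1)] that by blast
      show "simplicial_map (cone_complex n k (insert T ?G)) B u" using less.prems(5) TF by simp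
    qed auto
    then show ?thesis using TF by simp
  qed
qed

lemma horn_lift:
  assumes X: "simplicial_set X" and p: "kan_fibration X B p" and n: "1 \<le> n" and k: "k \<le> n"
    and u: "simplicial_map (horn n k) B u"
    and r: "r \<in> simplices X 0" "p 0 r = u 0 (restrict (\<lambda>_. k) {..0})"
  obtains w where "simplicial_map (horn n k) X w"
    "\<And>m x. x \<in> simplices (horn n k) m \<Longrightarrow> p m (w m x) = u m x"
proof -
  \<comment> \<open>Here \<open>1 \<le> n\<close> enters: a second vertex makes \<open>{}\<close> a
    proper subset, so the apex belongs to the horn and the induction can start from it.\<close>
  have "{..n} - {k} \<noteq> {}"
  proof (cases "k = 0")
    case True then show ?thesis using n by auto
  next
    case False then show ?thesis by auto
  qed
  moreover have "finite {T. T \<subset> {..n} - {k}}"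
    by (rule finite_subset[of _ "Pow {..n}"]) auto
  ultimately have "\<exists>w. simplicial_map (horn n k) X w \<and>
      (\<forall>m. \<forall>x \<in> simplices (horn n k) m. p m (w m x) = u m x)"
    using u unfolding horn_eq_cone_complex[OF k]
    by (intro cone_complex_lift[where p = p and u = u and r = r, OF X _ k])
      (use p r in \<open>auto simp: psubset_eq\<close>)
  then show ?thesis using that by blast
qed

lemma horn_vertex:
  assumes "1 \<le> n" "k \<le> n"
  shows "restrict (\<lambda>_. k) {..0} \<in> simplices (horn n k) 0"
proof -
  \<comment> \<open>The chosen number is a vertex different from \<open>k\<close>; the constant
    simplex at \<open>k\<close> omits it and so lies in the opposite face.\<close>
  have "(if k = 0 then 1 else 0) \<le> n \<and> (if k = 0 then 1 else 0) \<noteq> k" using assms by auto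
  then show ?thesis using delta_const_in_delta_hom[OF assms(2), of 0]
    by (auto simp: horn_def)
qed

section \<open>Simplices as maps, maps into products, and extension into Kan complexes\<close>

lemma yoneda_map:
  assumes "simplicial_set X" "x \<in> simplices X n"
  shows "simplicial_map (std_simplex n) X (\<lambda>m f. act X m n f x)"
  using assms by (auto simp: simplicial_set_def simplicial_map_def std_simplex_def Pi_iff)

lemma yoneda_eq:
  assumes "simplicial_map (std_simplex n) X v" "f \<in> delta_hom m n"
  shows "act X m n f (v n (delta_id n)) = v m f"
  using simplicial_map_act[OF assms, of "delta_id n"] assms(2)
  by (simp add: std_simplex_def delta_comp_id_left)

lemma simplicial_map_pair:
  "simplicial_map X Y p \<Longrightarrow> simplicial_map X Z q \<Longrightarrow>
    simplicial_map X (sset_prod Y Z) (smap_pair p q)"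
  by (auto simp: simplicial_map_def smap_pair_def sset_prod_def)

lemma simplicial_map_pairD:
  assumes "simplicial_map X (sset_prod Y Z) (smap_pair p q)"
  shows "simplicial_map X Y p" "simplicial_map X Z q"
  using assms by (auto simp: simplicial_map_def smap_pair_def sset_prod_def)

lemma simplicial_map_to_point: "simplicial_map X sset_point smap_to_point"
  by (simp add: simplicial_map_def sset_point_def smap_to_point_def)

lemma kan_complex_extend:
  assumes "kan_complex Y" "1 \<le> n" "k \<le> n" "simplicial_map (horn n k) Y u"
  obtains w where "simplicial_map (std_simplex n) Y w"
    "\<And>m x. x \<in> simplices (horn n k) m \<Longrightarrow> w m x = u m x"
  by (rule kan_fibrationD[of Y sset_point smap_to_point n k u smap_to_point])
    (use assms simplicial_map_to_point that in \<open>auto simp: kan_complex_def smap_to_point_def\<close>)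

section \<open>Quotients by pseudo-equivalence relations\<close>

text \<open>Levelwise, \<open>\<sigma>\<close> and \<open>\<tau>\<close> make the image of
  \<open>R\<close> symmetric and transitive, so a zigzag of generating pairs shortens to the pair of
  a single simplex of \<open>R\<close>.\<close>

lemma coeq_rel_pseudo_equivalence:
  assumes R: "pseudo_equivalence_relation Y R s t"
    and xy: "(x, y) \<in> coeq_rel R s t n" and x: "x \<in> simplices Y n"
  obtains r where "r \<in> simplices R n" "s n r = x" "t n r = y"
proof -
  obtain \<rho> \<sigma> \<tau> where \<rho>: "simplicial_map Y R \<rho>"
      "smap_eq Y (smap_pair s t \<odot> \<rho>) (smap_pair smap_id smap_id)"
    and \<sigma>: "simplicial_map R R \<sigma>" "smap_eq R (s \<odot> \<sigma>) t" "smap_eq R (t \<odot> \<sigma>) s"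
    and \<tau>: "simplicial_map (sset_pullback R R t s) R \<tau>"
      "smap_eq (sset_pullback R R t s) (s \<odot> \<tau>) (s \<odot> smap_fst)"
      "smap_eq (sset_pullback R R t s) (t \<odot> \<tau>) (t \<odot> smap_snd)"
    using R by (auto simp: pseudo_equivalence_relation_def Let_def)
  \<comment> \<open>The relation \<open>coeq_rel\<close> is reflexive on the whole type, whereas
    \<open>\<rho>\<close> acts on simplices of \<open>Y\<close>. Equality is therefore kept as an
    alternative in the induction and resolved by \<open>\<rho>\<close> at the end.\<close>
  have "x = y \<or> (\<exists>r \<in> simplices R n. s n r = x \<and> t n r = y)"
    using xy
  proof (induction rule: coeq_rel_induct)
    case (trans x y z)
    have "\<exists>r \<in> simplices R n. s n r = s n a \<and> t n r = t n b"
      if "a \<in> simplices R n" "b \<in> simplices R n" "t n a = s n b" for a b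
    proof -
      have "(a, b) \<in> simplices (sset_pullback R R t s) n"
        using that by (simp add: sset_pullback_def)
      then show ?thesis using \<tau> simplicial_map_closed[OF \<tau>(1)]
        by (intro bexI[of _ "\<tau> n (a, b)"])
          (auto simp: smap_eq_def smap_comp_def smap_fst_def smap_snd_def)
    qed
    then show ?case using trans by metis
  next
    case (sym x y)
    then show ?case using \<sigma>(2,3) simplicial_map_closed[OF \<sigma>(1)]
      unfolding smap_eq_def smap_comp_def comp_apply by metis
  qed auto
  moreover have "\<rho> n x \<in> simplices R n" "s n (\<rho> n x) = x" "t n (\<rho> n x) = x"
    using \<rho> x simplicial_map_closed[OF \<rho>(1)]
    by (auto simp: smap_eq_def smap_comp_def smap_pair_def smap_id_def)
  ultimately show ?thesis using that by auto
qed

text \<open>Surjectivity on vertices lifts the vertex \<open>k\<close> of a horn in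
  \<open>Q\<close>, and \<open>horn_lift\<close> then lifts the horn; the image of a filler in
  \<open>Y\<close> fills the given horn.\<close>

lemma kan_complex_image:
  assumes Y: "kan_complex Y" and Q: "simplicial_set Q" and q: "kan_fibration Y Q q"
    and surj: "simplices Q 0 \<subseteq> q 0 ` simplices Y 0"
  shows "kan_complex Q"
proof -
  have q': "simplicial_map Y Q q" and Y': "simplicial_set Y"
    using q Y by (simp_all add: kan_fibration_def kan_complex_def)
  have "\<exists>w. simplicial_map (std_simplex n) Q w \<and> smap_eq (horn n k) w u"
    if n: "1 \<le> n" "k \<le> n" and u: "simplicial_map (horn n k) Q u" for n k u
  proof -
    obtain y where "y \<in> simplices Y 0" "q 0 y = u 0 (restrict (\<lambda>_. k) {..0})"
      using surj simplicial_map_closed[OF u horn_vertex[OF n]] by (metis imageE subsetD)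
    then obtain u' where u': "simplicial_map (horn n k) Y u'"
      "\<And>m x. x \<in> simplices (horn n k) m \<Longrightarrow> q m (u' m x) = u m x"
      using horn_lift[OF Y' q n u] by blast
    then obtain w where "simplicial_map (std_simplex n) Y w"
      "\<And>m x. x \<in> simplices (horn n k) m \<Longrightarrow> w m x = u' m x"
      using kan_complex_extend[OF Y n] by blast
    then show ?thesis using u'(2) simplicial_map_comp[OF _ q']
      by (intro exI[of _ "q \<odot> w"]) (auto simp: smap_eq_def smap_comp_def)
  qed
  then show ?thesis
    using Q simplicial_map_to_point[of Q]
    by (auto simp: kan_complex_def kan_fibration_def smap_eq_def smap_comp_def smap_to_point_def)
qed

text \<open>Surjectivity in all dimensions lifts the simplex \<open>v\<close>. Condition
  \<open>ker\<close> concerns vertices because \<open>horn_lift\<close> starts from a lift of one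
  vertex.\<close>

lemma kan_fibration_quotient:
  assumes R: "simplicial_set R"
    and st: "kan_fibration R (sset_prod Y Y) (smap_pair s t)"
    and Y: "kan_complex Y" and q: "simplicial_map Y Q q"
    and qst: "smap_eq R (q \<odot> s) (q \<odot> t)"
    and surj: "\<And>n. simplices Q n \<subseteq> q n ` simplices Y n"
    and ker: "\<And>x y. x \<in> simplices Y 0 \<Longrightarrow> y \<in> simplices Y 0 \<Longrightarrow> q 0 x = q 0 y \<Longrightarrow>
      \<exists>r \<in> simplices R 0. s 0 r = x \<and> t 0 r = y"
  shows "kan_fibration Y Q q"
  unfolding kan_fibration_def
proof (intro conjI allI impI; (elim conjE)?)
  show "simplicial_map Y Q q" by (rule q)
next
  fix n k u v
  assume n: "1 \<le> n" "k \<le> n" and u: "simplicial_map (horn n k) Y u"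
    and v: "simplicial_map (std_simplex n) Q v" and "smap_eq (horn n k) (q \<odot> u) v"
  then have quv: "q m (u m x) = v m x" if "x \<in> simplices (horn n k) m" for m x
    using that by (auto simp: smap_eq_def smap_comp_def)
  have Y': "simplicial_set Y" using Y by (simp add: kan_complex_def)
  have "v n (delta_id n) \<in> simplices Q n"
    by (rule simplicial_map_closed[OF v]) (simp add: std_simplex_def)
  then obtain y where y: "y \<in> simplices Y n" "q n y = v n (delta_id n)"
    using surj by (metis imageE subsetD)
  \<comment> \<open>By Yoneda, the lift \<open>y\<close> of the top simplex of \<open>v\<close>
    determines a map \<open>v'\<close> with \<open>q \<odot> v' = v\<close> on the whole
    simplex.\<close>
  define v' where "v' m f = act Y m n f y" for m f
  have v': "simplicial_map (std_simplex n) Y v'"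
    unfolding v'_def by (rule yoneda_map[OF Y' y(1)])
  have qv': "q m (v' m f) = v m f" if "f \<in> delta_hom m n" for m f
    using simplicial_map_act[OF q that y(1)] yoneda_eq[OF v that] y(2) by (simp add: v'_def)
  have uv': "simplicial_map (horn n k) (sset_prod Y Y) (smap_pair u v')"
    by (rule simplicial_map_pair[OF u simplicial_map_horn[OF v']])
  let ?x = "restrict (\<lambda>_. k) {..0::nat}"
  have x: "?x \<in> simplices (horn n k) 0" by (rule horn_vertex[OF n])
  then have "?x \<in> delta_hom 0 n" by (simp add: horn_def)
  \<comment> \<open>At the vertex \<open>k\<close> both \<open>u\<close> and \<open>v'\<close> lie
    over the value of \<open>v\<close>, so \<open>ker\<close> relates them by a vertex of
    \<open>R\<close>.\<close>
  then obtain r0 where r0: "r0 \<in> simplices R 0" "s 0 r0 = u 0 ?x" "t 0 r0 = v' 0 ?x"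
    using ker[of "u 0 ?x" "v' 0 ?x"] simplicial_map_closed[OF u x] quv[OF x] qv'
      simplicial_map_closed[OF simplicial_map_horn[OF v'] x] by auto
  then have "smap_pair s t 0 r0 = smap_pair u v' 0 ?x" by (simp add: smap_pair_def)
  then obtain r where r: "simplicial_map (horn n k) R r"
    "\<And>m x. x \<in> simplices (horn n k) m \<Longrightarrow> smap_pair s t m (r m x) = smap_pair u v' m x"
    using horn_lift[OF R st n uv' r0(1)] by blast
  obtain w where w: "simplicial_map (std_simplex n) Y w"
    "\<And>m x. x \<in> simplices (horn n k) m \<Longrightarrow> w m x = u m x"
    using kan_complex_extend[OF Y n u] by blast
  \<comment> \<open>Since \<open>w\<close> extends \<open>u\<close>, the horn \<open>r\<close> in
    \<open>R\<close> lies over the restriction of \<open>(w, v')\<close>, now defined on the full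
    simplex. This is a lifting problem for \<open>(s, t)\<close>.\<close>
  have "smap_pair s t m (r m x) = smap_pair w v' m x" if "x \<in> simplices (horn n k) m" for m x
    using r(2)[OF that] w(2)[OF that] by (simp add: smap_pair_def)
  then obtain z where z: "simplicial_map (std_simplex n) R z"
    "\<And>m x. x \<in> delta_hom m n \<Longrightarrow> smap_pair s t m (z m x) = smap_pair w v' m x"
    using kan_fibrationD[OF st n r(1) simplicial_map_pair[OF w(1) v']] by metis
  \<comment> \<open>The simplex \<open>z\<close> relates \<open>w\<close> to \<open>v'\<close>, and
    \<open>q\<close> identifies the two ends of every simplex of \<open>R\<close>.\<close>
  have "q m (w m x) = v m x" if x: "x \<in> delta_hom m n" for m x
  proof -
    have "z m x \<in> simplices R m"
      by (rule simplicial_map_closed[OF z(1)]) (simp add: std_simplex_def x)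
    then have "q m (s m (z m x)) = q m (t m (z m x))"
      using qst by (auto simp: smap_eq_def smap_comp_def)
    then show ?thesis using z(2)[OF x] qv'[OF x] by (simp add: smap_pair_def)
  qed
  then show "\<exists>w. simplicial_map (std_simplex n) Y w \<and>
      smap_eq (horn n k) w u \<and> smap_eq (std_simplex n) (q \<odot> w) v"
    using w by (intro exI[of _ w]) (auto simp: smap_eq_def smap_comp_def std_simplex_def)
qed

theorem corollary4p4:
  fixes Y :: "'a sset" and R :: "'b sset" and s t :: "('b, 'a) smap"
    and Q :: "'c sset" and q :: "('a, 'c) smap"
  assumes "simplicial_set Y" and "simplicial_set R"
    and "pseudo_equivalence_relation Y R s t"
    and "kan_fibration R (sset_prod Y Y) (smap_pair s t)"
    and "kan_complex Y"
    and "is_coequalizer R Y s t Q q"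
  shows "kan_complex Q \<and> kan_fibration Y Q q"
proof -
  have st: "simplicial_map R Y s" "simplicial_map R Y t"
    using assms(3) simplicial_map_pairD by (auto simp: pseudo_equivalence_relation_def)
  have Q: "simplicial_set Q" and q: "simplicial_map Y Q q"
    and qst: "smap_eq R (q \<odot> s) (q \<odot> t)"
    using assms(6) by (auto simp: is_coequalizer_def coequalizer_wrt_def)
  note sk = is_coequalizer_surj_ker[OF assms(1,2) st assms(6)]
  have "\<exists>r \<in> simplices R 0. s 0 r = x \<and> t 0 r = y"
    if "x \<in> simplices Y 0" "y \<in> simplices Y 0" "q 0 x = q 0 y" for x y
    using coeq_rel_pseudo_equivalence[OF assms(3)] sk(2) that by metis
  then have "kan_fibration Y Q q"
    using sk(1) by (intro kan_fibration_quotient[OF assms(2,4,5) q qst]) auto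
  then show ?thesis using kan_complex_image[OF assms(5) Q] sk(1) by auto
qed

end
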